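(* Let $n\ge 1$ and let $(A(t))_{t\in\mathbb{N}}$ be a sequence of row-stochastic $n\times n$ matrices with positive diagonals. Let $0<t_0<t_1<\dots$ be a sequence of natural numbers such that for all $i\in\mathbb{N}$ it holds that $A(t_{i+1},t_i)\sim A(t_1,t_0)$ and such that all diagonal Gantmacher blocks of $A(t_{i+1},t_i)$ are positive and each nondiagonal Gantmacher block of $A(t_{i+1},t_i)$ is either positive or zero. Let $\mathcal{I}_1,\dots,\mathcal{I}_g$ be the essential classes of $A(t_1,t_0)$ and let $\mathcal{J}$ be the union of all inessential classes of $A(t_1,t_0)$. Let $(\delta_i)_{i\in\mathbb{N}}$ be real numbers. If $\min^{+}A(t_{i+1},t_i)\ge\delta_i$ for all $i\in\mathbb{N}$ and $\sum_{i=1}^\infty\delta_i=\infty$, then, with rows and columns sorted by simultaneous permutation according to $\mathcal{I}_1,\dots,\mathcal{I}_g,\mathcal{J}$, $$\lim_{t\to\infty}A(t,0)=\left[\begin{array}{ccc|c}K_1& &0&0\\ &\ddots& &\vdots\\ 0& &K_g&0\\ \hline &\text{not converging}& &0\end{array}\right]A(t_0,0),$$ where $K_1,\dots,K_g$ are consensus matrices. The display means the following: $A(t,0)=A(t,t_0)A(t_0,0)$ for $t\ge t_0$, and as $t\to\infty$, (i) for every $k\in\{1,\dots,g\}$ the block $A(t,t_0)_{[\mathcal{I}_k,\mathcal{I}_k]}$ converges to a consensus matrix $K_k$; (ii) for every $k\in\{1,\dots,g\}$ the blocks $A(t,t_0)_{[\mathcal{I}_k,\mathcal{I}_l]}$ with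 $l\neq k$ and $A(t,t_0)_{[\mathcal{I}_k,\mathcal{J}]}$ converge to $0$; (iii) the block $A(t,t_0)_{[\mathcal{J},\mathcal{J}]}$ converges to $0$. No convergence is asserted for the blocks $A(t,t_0)_{[\mathcal{J},\mathcal{I}_k]}$.
   Context: $\mathbb{N}=\{0,1,2,\dots\}$ and $\underline{n}=\{1,\dots,n\}$. For natural numbers $s<t$ the backward accumulation is $A(t,s):=A(t-1)A(t-2)\cdots A(s)$, and $A(s,s)$ is the identity matrix. For a matrix $A$ and index sets $\mathcal{I},\mathcal{J}$, $A_{[\mathcal{I},\mathcal{J}]}$ denotes the submatrix with rows indexed by $\mathcal{I}$ and columns indexed by $\mathcal{J}$. A consensus matrix is a row-stochastic matrix of rank 1, i.e. a row-stochastic matrix all of whose rows are equal. For a row-stochastic matrix $A$, the positive minimum $\min^{+}A$ is the smallest positive entry of $A$. Two nonnegative matrices $A,B$ of the same size are of the same type, written $A\sim B$, if for all $i,j$: $a_{ij}>0\Leftrightarrow b_{ij}>0$. Let $A$ be a nonnegative $n\times n$ matrix with positive diagonal. For $i,j\in\underline{n}$ write $i\rightarrow j$ if there is a sequence of indices $i=i_1,\dots,i_k=j$ with $a_{i_l,i_{l+1}}>0$ for all $l\in\{1,\dots,k-1\}$. Indices $i,j$ communicate if $i\rightarrow j$ and $j\rightarrow i$; because of the positive diagonal this is an equivalence relation, and its equivalence classes are denoted $\mathcal{I}_1,\dots,\mathcal{I}_p$. An index $i$ is essential if $i\rightarrow j$ implies $j\rightarrow i$ for every $j\in\underline{n}$,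 and inessential otherwise; these notions extend to classes. For classes, $\mathcal{J}'\rightarrow\mathcal{I}$ means that there is a path from an index of $\mathcal{J}'$ to an index of $\mathcal{I}$. Number the classes so that the essential classes $\mathcal{I}_1,\dots,\mathcal{I}_g$ come first, followed by the inessential classes $\mathcal{I}_{g+1},\dots,\mathcal{I}_p$, with a class $\mathcal{I}$ placed before a different class $\mathcal{J}'$ if $\mathcal{J}'\rightarrow\mathcal{I}$. Simultaneously permuting rows and columns of $A$ according to this order gives the Gantmacher form of $A$, a lower block triangular matrix. Its diagonal Gantmacher blocks are $A_{[\mathcal{I}_k,\mathcal{I}_k]}$, $k=1,\dots,p$, and its nondiagonal Gantmacher blocks are $A_{[\mathcal{I}_k,\mathcal{I}_l]}$ for $k=g+1,\dots,p$ and $l=1,\dots,k-1$. All other blocks are zero. "Positive" for a block means entrywise positive. A sequence $(t_i)$ with the properties required in the claim exists for every sequence of nonnegative matrices with positive diagonals. *)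

theory Defs
  imports "HOL-Analysis.Analysis"
begin

definition nonneg_mat :: "real ^ 'n ^ 'n \<Rightarrow> bool" where
  "nonneg_mat A \<longleftrightarrow> (\<forall>i j. A $ i $ j \<ge> 0)"

definition positive_diagonal :: "real ^ 'n ^ 'n \<Rightarrow> bool" where
  "positive_diagonal A \<longleftrightarrow> (\<forall>i. A $ i $ i > 0)"

definition row_stochastic :: "real ^ 'n ^ 'n \<Rightarrow> bool" where
  "row_stochastic A \<longleftrightarrow> nonneg_mat A \<and> (\<forall>i. (\<Sum>j\<in>UNIV. A $ i $ j) = 1)"

text \<open>A block of a matrix is given by the ambient matrix together with the sets of row and column
  indices; the predicates on blocks below look at the entries in these rows and columns only.\<close>

definition consensus_block :: "real ^ 'n ^ 'n \<Rightarrow> 'n set \<Rightarrow> bool" where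
  "consensus_block K C \<longleftrightarrow>
     (\<forall>i\<in>C. \<forall>j\<in>C. K $ i $ j \<ge> 0) \<and>
     (\<forall>i\<in>C. (\<Sum>j\<in>C. K $ i $ j) = 1) \<and>
     (\<forall>i\<in>C. \<forall>i'\<in>C. \<forall>j\<in>C. K $ i $ j = K $ i' $ j)"

definition positive_block :: "real ^ 'n ^ 'n \<Rightarrow> 'n set \<Rightarrow> 'n set \<Rightarrow> bool" where
  "positive_block A R C \<longleftrightarrow> (\<forall>i\<in>R. \<forall>j\<in>C. A $ i $ j > 0)"

definition zero_block :: "real ^ 'n ^ 'n \<Rightarrow> 'n set \<Rightarrow> 'n set \<Rightarrow> bool" where
  "zero_block A R C \<longleftrightarrow> (\<forall>i\<in>R. \<forall>j\<in>C. A $ i $ j = 0)"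

definition block_tendsto ::
    "(nat \<Rightarrow> real ^ 'n ^ 'n) \<Rightarrow> 'n set \<Rightarrow> 'n set \<Rightarrow> real ^ 'n ^ 'n \<Rightarrow> bool" where
  "block_tendsto X R C L \<longleftrightarrow> (\<forall>i\<in>R. \<forall>j\<in>C. (\<lambda>t. X t $ i $ j) \<longlonglongrightarrow> L $ i $ j)"

text \<open>\<open>backward_acc A t s\<close> is \<open>A (t - 1) ** A (t - 2) ** \<dots> ** A s\<close> for \<open>s < t\<close>. It is the identity
  for \<open>t = s\<close>, and for \<open>t < s\<close> too, a case that is never used.\<close>

primrec backward_acc ::
    "(nat \<Rightarrow> real ^ 'n ^ 'n) \<Rightarrow> nat \<Rightarrow> nat \<Rightarrow> real ^ 'n ^ 'n" where
  "backward_acc A 0 s = mat 1"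
| "backward_acc A (Suc t) s = (if s \<le> t then A t ** backward_acc A t s else mat 1)"

definition pos_min :: "real ^ 'n ^ 'n \<Rightarrow> real" where
  "pos_min A = Min {a. a > 0 \<and> (\<exists>i j. a = A $ i $ j)}"

definition same_type :: "real ^ 'n ^ 'n \<Rightarrow> real ^ 'n ^ 'n \<Rightarrow> bool" where
  "same_type A B \<longleftrightarrow> (\<forall>i j. A $ i $ j > 0 \<longleftrightarrow> B $ i $ j > 0)"

definition reaches :: "real ^ 'n ^ 'n \<Rightarrow> 'n \<Rightarrow> 'n \<Rightarrow> bool" where
  "reaches A = (\<lambda>i j. A $ i $ j > 0)\<^sup>*\<^sup>*"

definition communicate :: "real ^ 'n ^ 'n \<Rightarrow> ('n \<times> 'n) set" where
  "communicate A = {(i, j). reaches A i j \<and> reaches A j i}"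

definition comm_classes :: "real ^ 'n ^ 'n \<Rightarrow> 'n set set" where
  "comm_classes A = UNIV // communicate A"

definition essential :: "real ^ 'n ^ 'n \<Rightarrow> 'n \<Rightarrow> bool" where
  "essential A i \<longleftrightarrow> (\<forall>j. reaches A i j \<longrightarrow> reaches A j i)"

definition essential_class :: "real ^ 'n ^ 'n \<Rightarrow> 'n set \<Rightarrow> bool" where
  "essential_class A C \<longleftrightarrow> (\<forall>i\<in>C. essential A i)"

definition class_reaches :: "real ^ 'n ^ 'n \<Rightarrow> 'n set \<Rightarrow> 'n set \<Rightarrow> bool" where
  "class_reaches A C D \<longleftrightarrow> (\<exists>i\<in>C. \<exists>j\<in>D. reaches A i j)"

text \<open>The order of the classes in the Gantmacher form: \<open>I 1, \<dots>, I p\<close> lists every class once, the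
  essential classes are \<open>I 1, \<dots>, I g\<close>, and a class precedes every other class that reaches it.\<close>

definition gantmacher_numbering ::
    "real ^ 'n ^ 'n \<Rightarrow> nat \<Rightarrow> nat \<Rightarrow> (nat \<Rightarrow> 'n set) \<Rightarrow> bool" where
  "gantmacher_numbering A g p I \<longleftrightarrow>
     g \<le> p \<and> bij_betw I {1..p} (comm_classes A) \<and>
     (\<forall>k\<in>{1..p}. essential_class A (I k) \<longleftrightarrow> k \<le> g) \<and>
     (\<forall>k\<in>{1..p}. \<forall>l\<in>{1..p}. k \<noteq> l \<and> class_reaches A (I l) (I k) \<longrightarrow> k < l)"

definition diagonal_gantmacher_blocks_positive ::
    "real ^ 'n ^ 'n \<Rightarrow> nat \<Rightarrow> (nat \<Rightarrow> 'n set) \<Rightarrow> bool" where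
  "diagonal_gantmacher_blocks_positive A p I \<longleftrightarrow> (\<forall>k\<in>{1..p}. positive_block A (I k) (I k))"

definition nondiagonal_gantmacher_blocks_positive_or_zero ::
    "real ^ 'n ^ 'n \<Rightarrow> nat \<Rightarrow> nat \<Rightarrow> (nat \<Rightarrow> 'n set) \<Rightarrow> bool" where
  "nondiagonal_gantmacher_blocks_positive_or_zero A g p I \<longleftrightarrow>
     (\<forall>k\<in>{g+1..p}. \<forall>l\<in>{1..k-1}. positive_block A (I k) (I l) \<or> zero_block A (I k) (I l))"

text \<open>Matrices of the same type have the same Gantmacher numberings, so one numbering serves for a
  whole family of matrices of the same type; and a Gantmacher numbering always exists.\<close>

lemma gantmacher_numbering_same_type:
  assumes "same_type A B"
  shows "gantmacher_numbering A = gantmacher_numbering B"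
proof -
  have r: "reaches A = reaches B"
    using assms unfolding reaches_def same_type_def by simp
  have "comm_classes A = comm_classes B"
    unfolding comm_classes_def communicate_def r ..
  moreover have "essential_class A = essential_class B" "class_reaches A = class_reaches B"
    unfolding essential_class_def essential_def class_reaches_def r by (rule refl)+
  ultimately show ?thesis
    unfolding gantmacher_numbering_def by (intro ext) simp
qed

lemma reaches_trans: "reaches A i j \<Longrightarrow> reaches A j k \<Longrightarrow> reaches A i k"
  unfolding reaches_def by (rule rtranclp_trans)

lemma reaches_refl: "reaches A i i"
  unfolding reaches_def by simp

lemma equiv_communicate: "equiv UNIV (communicate A)"
  unfolding equiv_def refl_on_def sym_def trans_def communicate_def
  by (auto intro: reaches_refl reaches_trans)

lemma comm_class_reaches:
  assumes "C \<in> comm_classes A" "i \<in> C" "j \<in> C"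
  shows "reaches A i j"
proof -
  have "(i, j) \<in> communicate A"
    using quotient_eq_iff[OF equiv_communicate[of A], of C C i j] assms
    by (simp add: comm_classes_def)
  then show ?thesis by (simp add: communicate_def)
qed

lemma comm_class_eqI:
  assumes "C \<in> comm_classes A" "D \<in> comm_classes A" "i \<in> C" "j \<in> D"
    "reaches A i j" "reaches A j i"
  shows "C = D"
  using quotient_eqI[OF equiv_communicate[of A], of C D i j] assms
  by (simp add: comm_classes_def communicate_def)

lemma gantmacher_numbering_exists:
  fixes A :: "real ^ 'n ^ 'n"
  shows "\<exists>g p I. gantmacher_numbering A g p I"
proof -
  define f where "f C = card {j. \<exists>i\<in>C. reaches A i j}" for C
  have f_less: "f D < f C"
    if C: "C \<in> comm_classes A" and D: "D \<in> comm_classes A" and "C \<noteq> D" and CD: "class_reaches A C D"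
    for C D
  proof -
    obtain i j where ij: "i \<in> C" "j \<in> D" "reaches A i j"
      using CD by (auto simp: class_reaches_def)
    have no: "\<not> reaches A d i" if "d \<in> D" for d
      using comm_class_eqI[OF C D ij(1,2) ij(3)] \<open>C \<noteq> D\<close> comm_class_reaches[OF D ij(2) that]
        reaches_trans by blast
    have "{k. \<exists>d\<in>D. reaches A d k} \<subseteq> {k. \<exists>c\<in>C. reaches A c k}"
    proof
      fix k assume "k \<in> {k. \<exists>d\<in>D. reaches A d k}"
      then obtain d where d: "d \<in> D" "reaches A d k" by blast
      have "reaches A i k"
        by (rule reaches_trans[OF ij(3) reaches_trans[OF comm_class_reaches[OF D ij(2) d(1)] d(2)]])
      then show "k \<in> {k. \<exists>c\<in>C. reaches A c k}" using ij(1) by blast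
    qed
    moreover have "i \<in> {k. \<exists>c\<in>C. reaches A c k}" "i \<notin> {k. \<exists>d\<in>D. reaches A d k}"
      using ij(1) no reaches_refl[of A i] by auto
    ultimately show ?thesis
      unfolding f_def by (intro psubset_card_mono) auto
  qed
  have ess_final: "D = C"
    if C: "C \<in> comm_classes A" and D: "D \<in> comm_classes A" and e: "essential_class A C"
      and CD: "class_reaches A C D" for C D
  proof -
    obtain i j where ij: "i \<in> C" "j \<in> D" "reaches A i j"
      using CD by (auto simp: class_reaches_def)
    have "reaches A j i"
      using e ij by (simp add: essential_class_def essential_def)
    with comm_class_eqI[OF C D ij] show ?thesis by simp
  qed
  define E where "E = {C \<in> comm_classes A. essential_class A C}"
  define N where "N = {C \<in> comm_classes A. \<not> essential_class A C}"
  have fin: "finite E" "finite N" by simp_all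
  obtain ys where ys: "set ys = E" "distinct ys"
    using finite_distinct_list[OF fin(1)] by blast
  obtain zs0 where zs0: "set zs0 = N" "distinct zs0"
    using finite_distinct_list[OF fin(2)] by blast
  define zs where "zs = sort_key f zs0"
  have zs: "set zs = N" "distinct zs" "sorted (map f zs)"
    using zs0 by (simp_all add: zs_def)
  define xs where "xs = ys @ zs"
  have xs: "set xs = comm_classes A" "distinct xs"
    using ys zs by (auto simp: xs_def E_def N_def)
  define p where "p = length xs"
  define g where "g = length ys"
  define I where "I k = xs ! (k - 1)" for k
  have bij: "bij_betw I {1..p} (comm_classes A)"
  proof (rule bij_betw_imageI)
    show "inj_on I {1..p}"
      using xs(2) by (intro inj_onI) (auto simp: I_def p_def nth_eq_iff_index_eq)
    have "I ` {1..p} = (\<lambda>k. xs ! k) ` ((\<lambda>k. k - 1) ` {1..p})"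
      unfolding image_image I_def ..
    also have "(\<lambda>k. k - 1) ` {1..p} = {..<p}"
    proof
      show "{..<p} \<subseteq> (\<lambda>k. k - 1) ` {1..p}"
      proof
        fix k assume "k \<in> {..<p}"
        then show "k \<in> (\<lambda>k. k - 1) ` {1..p}"
          by (intro image_eqI[of _ _ "Suc k"]) auto
      qed
    qed auto
    also have "(\<lambda>k. xs ! k) ` {..<p} = set xs"
      by (auto simp: p_def set_conv_nth)
    finally show "I ` {1..p} = comm_classes A" using xs by simp
  qed
  have I_mem: "I k \<in> comm_classes A" if "k \<in> {1..p}" for k
    using bij that by (auto simp: bij_betw_def)
  have ess: "essential_class A (I k) \<longleftrightarrow> k \<le> g" if k: "k \<in> {1..p}" for k
  proof (cases "k \<le> g")
    case True
    then have "I k = ys ! (k - 1)" "k - 1 < length ys"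
      using k by (auto simp: I_def xs_def g_def nth_append)
    then have "I k \<in> E" using ys(1) nth_mem[of "k - 1" ys] by simp
    then show ?thesis using True by (simp add: E_def)
  next
    case False
    then have "I k = zs ! (k - 1 - g)" "k - 1 - g < length zs"
      using k by (auto simp: I_def xs_def g_def p_def nth_append)
    then have "I k \<in> N" using zs(1) nth_mem[of "k - 1 - g" zs] by simp
    then show ?thesis using False by (simp add: N_def)
  qed
  have ord: "k < l"
    if k: "k \<in> {1..p}" and l: "l \<in> {1..p}" and "k \<noteq> l" and r: "class_reaches A (I l) (I k)" for k l
  proof (rule ccontr)
    assume "\<not> k < l"
    with \<open>k \<noteq> l\<close> have lk: "l < k" by simp
    have ne: "I l \<noteq> I k"
      using inj_onD[OF bij_betw_imp_inj_on[OF bij] _ l k] \<open>k \<noteq> l\<close> by metis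
    have less: "f (I k) < f (I l)"
      using f_less[OF I_mem[OF l] I_mem[OF k] ne r] .
    have "\<not> l \<le> g"
      using ess_final[OF I_mem[OF l] I_mem[OF k] _ r] ess[OF l] ne by metis
    then have "I l = zs ! (l - 1 - g)" "I k = zs ! (k - 1 - g)" "k - 1 - g < length zs"
      using k l lk by (auto simp: I_def xs_def g_def p_def nth_append)
    moreover have "l - 1 - g \<le> k - 1 - g" using lk by simp
    ultimately have "f (I l) \<le> f (I k)"
      using sorted_nth_mono[OF zs(3), of "l - 1 - g" "k - 1 - g"] by simp
    with less show False by simp
  qed
  have "g \<le> p" by (simp add: g_def p_def xs_def)
  then have "gantmacher_numbering A g p I"
    unfolding gantmacher_numbering_def using bij ess ord by blast
  then show ?thesis by blast
qed

end

theory Submission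
  imports Defs
begin

text \<open>
  Write \<open>B i\<close> for the accumulation of \<open>A\<close> over \<open>[\<tau> i, \<tau> (i + 1))\<close>; all the \<open>B i\<close> have the type of
  \<open>D = B 0\<close>. Every column of the accumulation from \<open>\<tau> 0\<close> is a trajectory \<open>x (t + 1) = A t x t\<close>,
  and each of its entries is a weighted average of the entries one step earlier. Since the
  diagonals are positive, a positive entry of \<open>A t\<close> with \<open>t \<ge> \<tau> 0\<close> survives in the \<open>B i\<close> whose
  interval contains \<open>t\<close> (\<open>entry_pos_imp_type_pos\<close>), so averages are taken only along edges of \<open>D\<close>
  at every time, not only at the times \<open>\<tau> i\<close>. In particular, mass never leaves an essential class,
  which gives the zero blocks in the essential rows.

  Over an essential class the spread \<open>max x - min x\<close> never increases, and each \<open>B i\<close> multiplies it by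
  at most \<open>1 - \<delta> i\<close>, because every entry of the block of \<open>B i\<close> is at least \<open>\<delta> i\<close>. As \<open>\<Sum>\<delta> i\<close>
  diverges, the spread tends to \<open>0\<close> (\<open>tendsto_zero_of_divergent_contraction\<close>). The maximum decreases
  and the minimum increases, so all entries of the column converge to one limit
  (\<open>column_converges_on_final_class\<close>).

  The block of the inessential classes cannot be contracted as a whole: an index may need several
  steps to get to an essential class, and products of several \<open>\<delta> i\<close> may well have a finite sum. The
  classes are treated one at a time in the Gantmacher order instead. An inessential class has an edge
  to an earlier class, and because blocks are positive or zero, each of its rows puts weight at
  least \<open>\<delta> i\<close> on the earlier classes in every single \<open>B i\<close>. If the column already vanishes in the limit
  on the earlier classes, the excess of its maximum over any \<open>\<eta> > 0\<close> therefore contracts by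
  \<open>1 - \<delta> i\<close> as well, and the column vanishes in the limit on this class too
  (\<open>column_vanishes_on_transient_class\<close>).
\<close>

section \<open>Contraction along a divergent series\<close>

text \<open>The bound \<open>1 - \<delta> \<le> exp (- \<delta>)\<close> turns the product of the contraction factors into
  \<open>exp\<close> of minus the partial sums of the \<open>\<delta> i\<close>: the rescaled values \<open>h i = f (\<tau> (i + 1)) exp (S i)\<close>
  are eventually decreasing. Monotonicity of \<open>f\<close> carries the conclusion over from the times \<open>\<tau> i\<close> to all
  times.\<close>

lemma tendsto_zero_of_divergent_contraction:
  fixes f :: "nat \<Rightarrow> real" and \<delta> :: "nat \<Rightarrow> real" and \<tau> :: "nat \<Rightarrow> nat"
  assumes nonneg: "\<And>t. 0 \<le> f t"
    and decr: "\<And>t. T \<le> t \<Longrightarrow> f (Suc t) \<le> f t"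
    and contr: "\<And>i. T \<le> \<tau> i \<Longrightarrow> f (\<tau> (Suc i)) \<le> (1 - \<delta> i) * f (\<tau> i)"
    and mono: "strict_mono \<tau>"
    and div: "filterlim (\<lambda>N. \<Sum>i=1..N. \<delta> i) at_top sequentially"
  shows "f \<longlonglongrightarrow> 0"
proof -
  define S where "S N = (\<Sum>i=1..N. \<delta> i)" for N
  define h where "h i = f (\<tau> (Suc i)) * exp (S i)" for i
  have big: "T \<le> \<tau> i" if "T \<le> i" for i
    using that strict_mono_imp_increasing[OF mono, of i] by simp
  have h_step: "h (Suc i) \<le> h i" if "T \<le> i" for i
  proof -
    have "f (\<tau> (Suc (Suc i))) \<le> (1 - \<delta> (Suc i)) * f (\<tau> (Suc i))"
      using contr[OF big, of "Suc i"] that by simp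
    also have "\<dots> \<le> exp (- \<delta> (Suc i)) * f (\<tau> (Suc i))"
      using exp_ge_add_one_self[of "- \<delta> (Suc i)"] nonneg by (intro mult_right_mono) auto
    finally have "h (Suc i) \<le> exp (- \<delta> (Suc i)) * f (\<tau> (Suc i)) * exp (S (Suc i))"
      unfolding h_def by (intro mult_right_mono) auto
    also have "\<dots> = h i"
      by (simp add: h_def S_def exp_add exp_minus)
    finally show ?thesis .
  qed
  have h_le: "h i \<le> h T" if "T \<le> i" for i
    using that
  proof (induction i rule: dec_induct)
    case (step i)
    then show ?case using h_step[of i] by simp
  qed simp
  have "filterlim (\<lambda>i. - S i) at_bot sequentially"
    using div unfolding S_def filterlim_uminus_at_top .
  then have "(\<lambda>i. exp (- S i)) \<longlonglongrightarrow> 0"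
    by (rule filterlim_compose[OF exp_at_bot])
  then have lim: "(\<lambda>i. h T * exp (- S i)) \<longlonglongrightarrow> 0"
    by (rule tendsto_mult_right_zero)
  show ?thesis
  proof (rule LIMSEQ_I)
    fix e :: real assume "0 < e"
    from order_tendstoD(2)[OF lim this] obtain i0 where i0: "\<And>i. i0 \<le> i \<Longrightarrow> h T * exp (- S i) < e"
      unfolding eventually_sequentially by blast
    define i where "i = max i0 T"
    have "f (\<tau> (Suc i)) = h i * exp (- S i)"
      by (simp add: h_def exp_minus)
    also have "\<dots> \<le> h T * exp (- S i)"
      using h_le[of i] by (intro mult_right_mono) (auto simp: i_def)
    also have "\<dots> < e" using i0[of i] by (simp add: i_def)
    finally have small: "f (\<tau> (Suc i)) < e" .
    have "f t < e" if "\<tau> (Suc i) \<le> t" for t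
      using that
    proof (induction t rule: dec_induct)
      case (step t)
      have "T \<le> t" using order_trans[OF big step.hyps(1)] by (simp add: i_def)
      then show ?case using decr[of t] step.IH by simp
    qed (rule small)
    then show "\<exists>t0. \<forall>t\<ge>t0. norm (f t - 0) < e"
      using nonneg by auto
  qed
qed

section \<open>Weighted averages\<close>

lemma row_stochastic_nonneg: "row_stochastic P \<Longrightarrow> 0 \<le> P $ a $ b"
  by (simp add: row_stochastic_def nonneg_mat_def)

lemma row_stochastic_sum: "row_stochastic P \<Longrightarrow> (\<Sum>b\<in>UNIV. P $ a $ b) = 1"
  by (simp add: row_stochastic_def)

lemma stochastic_average_le:
  assumes P: "row_stochastic P"
    and le: "\<And>b. P $ a $ b > 0 \<Longrightarrow> x b \<le> M"
  shows "(\<Sum>b\<in>UNIV. P $ a $ b * x b) \<le> M"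
proof -
  have "(\<Sum>b\<in>UNIV. P $ a $ b * x b) \<le> (\<Sum>b\<in>UNIV. P $ a $ b * M)"
    using le row_stochastic_nonneg[OF P, of a] 
    by (intro sum_mono) (metis less_eq_real_def mult_left_mono mult_zero_left)
  also have "\<dots> = M"
    using row_stochastic_sum[OF P, of a] by (simp flip: sum_distrib_right)
  finally show ?thesis .
qed

text \<open>The gap between \<open>M\<close> and the average is the average of the nonnegative gaps \<open>M - x b\<close>, and the
  entry \<open>c\<close> alone contributes \<open>w * (M - m)\<close> to it.\<close>

lemma stochastic_average_le_pulled:
  assumes P: "row_stochastic P"
    and le: "\<And>b. P $ a $ b > 0 \<Longrightarrow> x b \<le> M"
    and w: "w \<le> P $ a $ c" and c: "x c \<le> m" and "m \<le> M"
  shows "(\<Sum>b\<in>UNIV. P $ a $ b * x b) \<le> M - w * (M - m)"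
proof -
  have nn: "0 \<le> P $ a $ b" for b by (rule row_stochastic_nonneg[OF P])
  have "w * (M - m) \<le> P $ a $ c * (M - m)"
    using w \<open>m \<le> M\<close> by (intro mult_right_mono) auto
  also have "\<dots> \<le> P $ a $ c * (M - x c)"
    using c nn by (intro mult_left_mono) auto
  also have "\<dots> \<le> (\<Sum>b\<in>UNIV. P $ a $ b * (M - x b))"
  proof (rule member_le_sum)
    show "0 \<le> P $ a $ b * (M - x b)" for b
      using nn[of b] le[of b] by (cases "P $ a $ b = 0") auto
  qed auto
  also have "\<dots> = M - (\<Sum>b\<in>UNIV. P $ a $ b * x b)"
    using row_stochastic_sum[OF P, of a]
    by (simp add: right_diff_distrib sum_subtractf flip: sum_distrib_right)
  finally show ?thesis by simp
qed

section \<open>Backward accumulations of stochastic matrices\<close>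

lemma matrix_mult_entry: "(P ** Q) $ a $ b = (\<Sum>c\<in>UNIV. P $ a $ c * Q $ c $ b)"
  by (simp add: matrix_matrix_mult_def)

lemma matrix_mult_entry_ge:
  fixes P Q :: "real ^ 'n ^ 'n"
  assumes "nonneg_mat P" "nonneg_mat Q"
  shows "P $ a $ c * Q $ c $ b \<le> (P ** Q) $ a $ b"
  unfolding matrix_mult_entry using assms
  by (intro member_le_sum) (auto simp: nonneg_mat_def)

lemma row_stochastic_mult:
  assumes "row_stochastic P" "row_stochastic Q"
  shows "row_stochastic (P ** Q)"
proof -
  have "(\<Sum>b\<in>UNIV. (P ** Q) $ a $ b) = 1" for a
  proof -
    have "(\<Sum>b\<in>UNIV. (P ** Q) $ a $ b) = (\<Sum>c\<in>UNIV. P $ a $ c * (\<Sum>b\<in>UNIV. Q $ c $ b))"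
      unfolding matrix_mult_entry sum_distrib_left by (rule sum.swap)
    then show ?thesis
      by (simp add: row_stochastic_sum[OF assms(1)] row_stochastic_sum[OF assms(2)])
  qed
  moreover have "0 \<le> (P ** Q) $ a $ b" for a b
    unfolding matrix_mult_entry using assms by (simp add: sum_nonneg row_stochastic_nonneg)
  ultimately show ?thesis by (simp add: row_stochastic_def nonneg_mat_def)
qed

lemma positive_diagonal_mult:
  fixes P Q :: "real ^ 'n ^ 'n"
  assumes "nonneg_mat P" "nonneg_mat Q" "positive_diagonal P" "positive_diagonal Q"
  shows "positive_diagonal (P ** Q)"
  unfolding positive_diagonal_def
proof
  fix a
  have "0 < P $ a $ a * Q $ a $ a" using assms by (simp add: positive_diagonal_def)
  also have "\<dots> \<le> (P ** Q) $ a $ a" by (rule matrix_mult_entry_ge[OF assms(1,2)])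
  finally show "0 < (P ** Q) $ a $ a" .
qed

lemma backward_acc_self: "backward_acc A s s = mat 1"
  by (cases s) auto

lemma backward_acc_compose:
  assumes "s \<le> t" "t \<le> u"
  shows "backward_acc A u s = backward_acc A u t ** backward_acc A t s"
  using assms(2)
proof (induction u rule: dec_induct)
  case base
  show ?case by (simp add: backward_acc_self)
next
  case (step u)
  then show ?case using assms(1) by (simp add: matrix_mul_assoc)
qed

lemma row_stochastic_backward_acc:
  assumes "\<And>t. row_stochastic (A t)"
  shows "row_stochastic (backward_acc A t s)"
proof -
  have one: "row_stochastic (mat 1 :: real ^ 'n ^ 'n)"
    by (simp add: row_stochastic_def nonneg_mat_def mat_def)
  show ?thesis by (induction t) (auto simp: one assms row_stochastic_mult)
qed

lemma positive_diagonal_backward_acc: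
  assumes "\<And>t. row_stochastic (A t)" "\<And>t. positive_diagonal (A t)"
  shows "positive_diagonal (backward_acc A t s)"
proof (induction t)
  case 0
  show ?case by (simp add: positive_diagonal_def mat_def)
next
  case (Suc t)
  have "nonneg_mat (A t)" "nonneg_mat (backward_acc A t s)"
    using assms(1) row_stochastic_backward_acc[of A t s, OF assms(1)]
    by (simp_all add: row_stochastic_def)
  then have "positive_diagonal (A t ** backward_acc A t s)"
    by (intro positive_diagonal_mult Suc.IH assms(2))
  then show ?case by (simp add: positive_diagonal_def mat_def)
qed

text \<open>The positive diagonals keep the edge alive: stay at \<open>a\<close> after time \<open>t\<close> and at \<open>b\<close> before it.\<close>

lemma backward_acc_pos_of_entry_pos:
  assumes st: "\<And>t. row_stochastic (A t)" and dg: "\<And>t. positive_diagonal (A t)"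
    and t: "s \<le> t" "t < u" and pos: "A t $ a $ b > 0"
  shows "backward_acc A u s $ a $ b > 0"
proof -
  let ?P = "backward_acc A u (Suc t)" and ?Q = "backward_acc A t s"
  have nn: "nonneg_mat ?P" "nonneg_mat (A t)" "nonneg_mat ?Q"
      "nonneg_mat (backward_acc A (Suc t) s)"
    using st row_stochastic_backward_acc[of A, OF st] by (simp_all add: row_stochastic_def del: backward_acc.simps)
  have d: "?P $ a $ a > 0" "?Q $ b $ b > 0"
    using positive_diagonal_backward_acc[of A, OF st dg] by (simp_all add: positive_diagonal_def)
  have "0 < A t $ a $ b * ?Q $ b $ b" using pos d by simp
  also have "\<dots> \<le> backward_acc A (Suc t) s $ a $ b"
    using matrix_mult_entry_ge[OF nn(2,3), of a b b] t by simp
  finally have "0 < ?P $ a $ a * backward_acc A (Suc t) s $ a $ b" using d by simp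
  also have "\<dots> \<le> (?P ** backward_acc A (Suc t) s) $ a $ b"
    by (rule matrix_mult_entry_ge[OF nn(1,4)])
  also have "?P ** backward_acc A (Suc t) s = backward_acc A u s"
    using t by (intro backward_acc_compose[symmetric]) auto
  finally show ?thesis .
qed

lemma pos_min_le:
  fixes P :: "real ^ 'n ^ 'n"
  assumes "P $ a $ b > 0"
  shows "pos_min P \<le> P $ a $ b"
proof -
  have "{c. c > 0 \<and> (\<exists>i j. c = P $ i $ j)} \<subseteq> (\<lambda>(i, j). P $ i $ j) ` UNIV"
    by auto
  then have "finite {c. c > 0 \<and> (\<exists>i j. c = P $ i $ j)}"
    by (rule finite_subset) simp
  then show ?thesis
    unfolding pos_min_def using assms by (intro Min_le) auto
qed

section \<open>Products of blocks of one type\<close>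

text \<open>Everything about a single class can be read off the common type \<open>D\<close>: an edge of \<open>D\<close> carries weight
  at least \<open>\<delta> i\<close> in each \<open>B i\<close>, and by \<open>entry_pos_imp_type_pos\<close> no single step from \<open>\<tau> 0\<close> on uses another edge.\<close>

locale same_type_blocks =
  fixes A :: "nat \<Rightarrow> real ^ 'n ^ 'n" and \<tau> :: "nat \<Rightarrow> nat" and \<delta> :: "nat \<Rightarrow> real"
    and D :: "real ^ 'n ^ 'n"
  assumes stochastic: "\<And>t. row_stochastic (A t)"
    and diagonal: "\<And>t. positive_diagonal (A t)"
    and mono: "strict_mono \<tau>"
    and type: "\<And>i. same_type (backward_acc A (\<tau> (Suc i)) (\<tau> i)) D"
    and min: "\<And>i. \<delta> i \<le> pos_min (backward_acc A (\<tau> (Suc i)) (\<tau> i))"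
    and divergent: "filterlim (\<lambda>N. \<Sum>i=1..N. \<delta> i) at_top sequentially"
begin

abbreviation X :: "nat \<Rightarrow> real ^ 'n ^ 'n" where "X t \<equiv> backward_acc A t (\<tau> 0)"

abbreviation B :: "nat \<Rightarrow> real ^ 'n ^ 'n" where "B i \<equiv> backward_acc A (\<tau> (Suc i)) (\<tau> i)"

lemma stochastic_acc: "row_stochastic (backward_acc A t s)"
  by (rule row_stochastic_backward_acc[of A, OF stochastic])

lemma \<tau>_le: "\<tau> 0 \<le> \<tau> i"
  using mono by (simp add: strict_mono_less_eq)

lemma B_pos_iff: "B i $ a $ b > 0 \<longleftrightarrow> D $ a $ b > 0"
  using type by (simp add: same_type_def)

lemma B_ge: "D $ a $ b > 0 \<Longrightarrow> \<delta> i \<le> B i $ a $ b"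
  using order_trans[OF min pos_min_le] B_pos_iff by blast

lemma entry_pos_imp_type_pos:
  assumes "\<tau> 0 \<le> t" "A t $ a $ b > 0"
  shows "D $ a $ b > 0"
proof -
  have "\<exists>i. \<tau> i \<le> t \<and> t < \<tau> (Suc i)"
  proof -
    have "t < \<tau> (Suc t)"
      using strict_mono_imp_increasing[OF mono, of "Suc t"] by simp
    then have "\<exists>n. t < \<tau> n" by blast
    moreover define n where "n = (LEAST n. t < \<tau> n)"
    ultimately have n: "t < \<tau> n" by (auto intro: LeastI_ex)
    with assms(1) obtain i where i: "n = Suc i" by (cases n) auto
    then have "\<not> t < \<tau> i" by (intro not_less_Least) (simp flip: n_def)
    then show ?thesis using n i by (intro exI[of _ i]) simp
  qed
  then obtain i where "\<tau> i \<le> t" "t < \<tau> (Suc i)" by blast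
  then have "B i $ a $ b > 0"
    using backward_acc_pos_of_entry_pos[of A, OF stochastic diagonal] assms(2) by blast
  then show ?thesis by (simp add: B_pos_iff)
qed

lemma X_Suc: "\<tau> 0 \<le> t \<Longrightarrow> X (Suc t) $ a $ j = (\<Sum>b\<in>UNIV. A t $ a $ b * X t $ b $ j)"
  by (simp add: matrix_mult_entry)

lemma X_\<tau>_Suc: "X (\<tau> (Suc i)) $ a $ j = (\<Sum>b\<in>UNIV. B i $ a $ b * X (\<tau> i) $ b $ j)"
proof -
  have "X (\<tau> (Suc i)) = B i ** X (\<tau> i)"
    using \<tau>_le mono by (intro backward_acc_compose) (auto simp: strict_mono_less_eq)
  then show ?thesis by (simp add: matrix_mult_entry)
qed

lemma X_pos_imp_reaches:
  assumes "\<tau> 0 \<le> t" "X t $ a $ b > 0"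
  shows "reaches D a b"
  using assms
proof (induction t arbitrary: a rule: dec_induct)
  case base
  then have "a = b" by (simp add: backward_acc_self mat_def split: if_splits)
  then show ?case by (simp add: reaches_refl)
next
  case (step t)
  then have "(\<Sum>c\<in>UNIV. A t $ a $ c * X t $ c $ b) > 0"
    by (simp only: X_Suc)
  then obtain c where "A t $ a $ c * X t $ c $ b > 0"
    using sum_nonpos[of UNIV "\<lambda>c. A t $ a $ c * X t $ c $ b"] by (meson not_le)
  then have c: "A t $ a $ c > 0" "X t $ c $ b > 0"
    using row_stochastic_nonneg[OF stochastic, of t a c] by (auto simp: zero_less_mult_iff)
  have "reaches D a c"
    using entry_pos_imp_type_pos[OF step.hyps(1) c(1)] unfolding reaches_def by (rule r_into_rtranclp)
  then show ?case using step.IH[OF c(2)] by (rule reaches_trans)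
qed

text \<open>The minimum of a column is the negative maximum of the negated column, so both of its bounds come
  from the upper bounds on averages.\<close>

lemma column_converges_on_final_class:
  assumes "C \<noteq> {}"
    and closed: "\<And>a b. a \<in> C \<Longrightarrow> D $ a $ b > 0 \<Longrightarrow> b \<in> C"
    and pos: "\<And>a b. a \<in> C \<Longrightarrow> b \<in> C \<Longrightarrow> D $ a $ b > 0"
  shows "\<exists>L. \<forall>a\<in>C. (\<lambda>t. X t $ a $ j) \<longlonglongrightarrow> L"
proof -
  define M where "M t = Max ((\<lambda>a. X t $ a $ j) ` C)" for t
  define m where "m t = Min ((\<lambda>a. X t $ a $ j) ` C)" for t
  have M_ge: "X t $ a $ j \<le> M t" and m_le: "m t \<le> X t $ a $ j" if "a \<in> C" for t a
    using that by (auto simp: M_def m_def)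
  have M_leI: "M t \<le> c" if "\<And>a. a \<in> C \<Longrightarrow> X t $ a $ j \<le> c" for t c
    using that \<open>C \<noteq> {}\<close> by (auto simp: M_def)
  have m_geI: "c \<le> m t" if "\<And>a. a \<in> C \<Longrightarrow> c \<le> X t $ a $ j" for t c
    using that \<open>C \<noteq> {}\<close> by (auto simp: m_def)
  have m_attained: "\<exists>c\<in>C. X t $ c $ j = m t" for t
  proof -
    have "m t \<in> (\<lambda>a. X t $ a $ j) ` C"
      unfolding m_def using \<open>C \<noteq> {}\<close> by (intro Min_in) auto
    then show ?thesis by auto
  qed
  have m_le_M: "m t \<le> M t" for t
    using \<open>C \<noteq> {}\<close> M_ge m_le by (metis ex_in_conv order_trans)
  have M_decr: "M (Suc t) \<le> M t" if t: "\<tau> 0 \<le> t" for t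
  proof (rule M_leI)
    fix a assume a: "a \<in> C"
    show "X (Suc t) $ a $ j \<le> M t"
      unfolding X_Suc[OF t]
      by (rule stochastic_average_le[OF stochastic], rule M_ge, rule closed[OF a])
        (rule entry_pos_imp_type_pos[OF t])
  qed
  have average_ge: "m s \<le> (\<Sum>b\<in>UNIV. P $ a $ b * X s $ b $ j)"
    if "row_stochastic P" "\<And>b. P $ a $ b > 0 \<Longrightarrow> b \<in> C" for P a s
    using stochastic_average_le[OF that(1), where a = a and x = "\<lambda>b. - X s $ b $ j" and M = "- m s"]
      that(2) m_le by (simp add: sum_negf)
  have m_incr: "m t \<le> m (Suc t)" if t: "\<tau> 0 \<le> t" for t
    unfolding X_Suc[OF t]
    by (rule m_geI, unfold X_Suc[OF t], rule average_ge[OF stochastic])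
      (use closed entry_pos_imp_type_pos[OF t] in blast)
  have B_closed: "b \<in> C" if "a \<in> C" "B i $ a $ b > 0" for a b i
    using that closed B_pos_iff by blast
  have spread: "(\<lambda>t. M t - m t) \<longlonglongrightarrow> 0"
  proof (rule tendsto_zero_of_divergent_contraction[where T = "\<tau> 0", OF _ _ _ mono divergent])
    show "0 \<le> M t - m t" for t using m_le_M by simp
    show "M (Suc t) - m (Suc t) \<le> M t - m t" if "\<tau> 0 \<le> t" for t
      using M_decr[OF that] m_incr[OF that] by simp
    show "M (\<tau> (Suc i)) - m (\<tau> (Suc i)) \<le> (1 - \<delta> i) * (M (\<tau> i) - m (\<tau> i))" for i
    proof -
      obtain c where c: "c \<in> C" "X (\<tau> i) $ c $ j = m (\<tau> i)" using m_attained by blast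
      have "M (\<tau> (Suc i)) \<le> M (\<tau> i) - \<delta> i * (M (\<tau> i) - m (\<tau> i))"
      proof (rule M_leI, unfold X_\<tau>_Suc, rule stochastic_average_le_pulled[OF stochastic_acc])
        fix a assume a: "a \<in> C"
        show "X (\<tau> i) $ b $ j \<le> M (\<tau> i)" if "B i $ a $ b > 0" for b
          using M_ge B_closed[OF a that] by blast
        show "\<delta> i \<le> B i $ a $ c" using B_ge pos a c by blast
        show "X (\<tau> i) $ c $ j \<le> m (\<tau> i)" using c by simp
      qed (rule m_le_M)
      moreover have "m (\<tau> i) \<le> m (\<tau> (Suc i))"
        by (rule m_geI, unfold X_\<tau>_Suc, rule average_ge[OF stochastic_acc]) (rule B_closed)
      ultimately show ?thesis by (simp add: algebra_simps)
    qed
  qed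
  (* The maximum decreases only from the start time on, where the accumulation begins. *)
  define M' where "M' n = M (n + \<tau> 0)" for n
  have decr: "decseq M'"
    by (rule decseq_SucI) (simp add: M'_def M_decr)
  have "0 \<le> M' n" for n
  proof -
    obtain a where "a \<in> C" using \<open>C \<noteq> {}\<close> by blast
    then show ?thesis
      using order_trans[OF row_stochastic_nonneg[OF stochastic_acc] M_ge] by (simp add: M'_def)
  qed
  then obtain L where "M' \<longlonglongrightarrow> L"
    using decseq_convergent[OF decr] by metis
  then have M_lim: "M \<longlonglongrightarrow> L"
    unfolding M'_def by (rule LIMSEQ_offset)
  then have m_lim: "m \<longlonglongrightarrow> L"
    using tendsto_diff[OF M_lim spread] by simp
  have "(\<lambda>t. X t $ a $ j) \<longlonglongrightarrow> L" if "a \<in> C" for a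
    by (rule tendsto_sandwich[OF _ _ m_lim M_lim]) (simp_all add: m_le M_ge that)
  then show ?thesis by blast
qed

text \<open>Once the column is below \<open>\<eta>\<close> on the successors outside \<open>C\<close>, the quantity that contracts is the
  excess over \<open>\<eta>\<close> of the maximum on \<open>C\<close>, cut off at \<open>0\<close>.\<close>

lemma column_vanishes_on_transient_class:
  assumes exit: "\<And>a. a \<in> C \<Longrightarrow> \<exists>c. c \<notin> C \<and> D $ a $ c > 0"
    and out: "\<And>a b. a \<in> C \<Longrightarrow> b \<notin> C \<Longrightarrow> D $ a $ b > 0 \<Longrightarrow> (\<lambda>t. X t $ b $ j) \<longlonglongrightarrow> 0"
    and "a \<in> C"
  shows "(\<lambda>t. X t $ a $ j) \<longlonglongrightarrow> 0"
proof (rule order_tendstoI)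
  fix e :: real assume "e < 0"
  then show "\<forall>\<^sub>F t in sequentially. e < X t $ a $ j"
    using row_stochastic_nonneg[OF stochastic_acc] by (intro always_eventually) (metis less_le_trans)
next
  fix e :: real assume "0 < e"
  define \<eta> where "\<eta> = e / 2"
  have "0 < \<eta>" using \<open>0 < e\<close> by (simp add: \<eta>_def)
  define R where "R = {b. b \<notin> C \<and> (\<exists>a\<in>C. D $ a $ b > 0)}"
  have "\<forall>\<^sub>F t in sequentially. \<forall>b\<in>R. X t $ b $ j < \<eta>"
  proof (rule eventually_ball_finite)
    show "\<forall>b\<in>R. \<forall>\<^sub>F t in sequentially. X t $ b $ j < \<eta>"
      using order_tendstoD(2)[OF out \<open>0 < \<eta>\<close>] by (auto simp: R_def)
  qed simp
  then obtain T0 where T0: "\<And>t b. T0 \<le> t \<Longrightarrow> b \<in> R \<Longrightarrow> X t $ b $ j < \<eta>"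
    unfolding eventually_sequentially by blast
  define T where "T = max T0 (\<tau> 0)"
  define M where "M t = Max (insert \<eta> ((\<lambda>a. X t $ a $ j) ` C))" for t
  have M_ge: "X t $ a $ j \<le> M t" if "a \<in> C" for t a
    using that by (auto simp: M_def)
  have M_ge_\<eta>: "\<eta> \<le> M t" for t
    by (simp add: M_def)
  have M_leI: "M t \<le> c" if "\<eta> \<le> c" "\<And>a. a \<in> C \<Longrightarrow> X t $ a $ j \<le> c" for t c
    using that by (auto simp: M_def)
  have succ: "X t $ b $ j \<le> M t" if "T \<le> t" "a \<in> C" "D $ a $ b > 0" for t a b
  proof (cases "b \<in> C")
    case False
    then have "X t $ b $ j < \<eta>" using that by (intro T0) (auto simp: R_def T_def)
    then show ?thesis using M_ge_\<eta>[of t] by simp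
  qed (rule M_ge)
  have "(\<lambda>t. M t - \<eta>) \<longlonglongrightarrow> 0"
  proof (rule tendsto_zero_of_divergent_contraction[where T = T, OF _ _ _ mono divergent])
    show "0 \<le> M t - \<eta>" for t using M_ge_\<eta> by simp
    show "M (Suc t) - \<eta> \<le> M t - \<eta>" if t: "T \<le> t" for t
    proof -
      have t': "\<tau> 0 \<le> t" using t by (simp add: T_def)
      have "M (Suc t) \<le> M t"
      proof (rule M_leI[OF M_ge_\<eta>])
        fix a assume a: "a \<in> C"
        show "X (Suc t) $ a $ j \<le> M t"
          unfolding X_Suc[OF t']
          by (rule stochastic_average_le[OF stochastic], rule succ[OF t a])
            (rule entry_pos_imp_type_pos[OF t'])
      qed
      then show ?thesis by simp
    qed
    show "M (\<tau> (Suc i)) - \<eta> \<le> (1 - \<delta> i) * (M (\<tau> i) - \<eta>)" if i: "T \<le> \<tau> i" for i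
    proof -
      have bound: "X (\<tau> (Suc i)) $ a $ j \<le> M (\<tau> i) - \<delta> i * (M (\<tau> i) - \<eta>)" if a: "a \<in> C" for a
      proof -
        obtain c where c: "c \<notin> C" "D $ a $ c > 0" using exit[OF a] by blast
        show ?thesis
          unfolding X_\<tau>_Suc
        proof (rule stochastic_average_le_pulled[OF stochastic_acc])
          show "X (\<tau> i) $ b $ j \<le> M (\<tau> i)" if "B i $ a $ b > 0" for b
            using succ[OF i a] that B_pos_iff by blast
          show "\<delta> i \<le> B i $ a $ c" by (rule B_ge[OF c(2)])
          show "X (\<tau> i) $ c $ j \<le> \<eta>"
            using T0[of "\<tau> i" c] i c a by (force simp: R_def T_def)
        qed (rule M_ge_\<eta>)
      qed
      (* M is cut off at \<eta>, so the bound on the class must itself be at least \<eta>. *)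
      have "\<delta> i \<le> 1"
      proof -
        obtain c where c: "D $ a $ c > 0" using exit[OF \<open>a \<in> C\<close>] by blast
        have "B i $ a $ c \<le> (\<Sum>b\<in>UNIV. B i $ a $ b)"
          by (rule member_le_sum) (auto intro: row_stochastic_nonneg[OF stochastic_acc])
        then show ?thesis
          using B_ge[OF c, of i] row_stochastic_sum[OF stochastic_acc, of "\<tau> (Suc i)" "\<tau> i" a] by simp
      qed
      then have "0 \<le> (1 - \<delta> i) * (M (\<tau> i) - \<eta>)"
        using M_ge_\<eta>[of "\<tau> i"] by simp
      then have "M (\<tau> (Suc i)) \<le> M (\<tau> i) - \<delta> i * (M (\<tau> i) - \<eta>)"
        by (intro M_leI bound) (simp_all add: algebra_simps)
      then show ?thesis by (simp add: algebra_simps)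
    qed
  qed
  then have "\<forall>\<^sub>F t in sequentially. M t - \<eta> < \<eta>"
    using \<open>0 < \<eta>\<close> by (rule order_tendstoD(2))
  then show "\<forall>\<^sub>F t in sequentially. X t $ a $ j < e"
  proof eventually_elim
    case (elim t)
    then show ?case using M_ge[OF \<open>a \<in> C\<close>, of t] by (simp add: \<eta>_def)
  qed
qed

end

section \<open>Communication classes\<close>

lemma comm_class_closed:
  assumes C: "C \<in> comm_classes D" and a: "a \<in> C" and ab: "reaches D a b" "reaches D b a"
  shows "b \<in> C"
  using in_quotient_imp_closed[OF equiv_communicate[of D], of C a b] assms
  by (simp add: comm_classes_def communicate_def)

lemma essential_class_closed:
  assumes "C \<in> comm_classes D" "essential_class D C" "a \<in> C" "reaches D a b"
  shows "b \<in> C"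
  using assms(2-4) comm_class_closed[OF assms(1,3,4)]
  by (simp add: essential_class_def essential_def)

lemma inessential_class_has_exit:
  assumes C: "C \<in> comm_classes D" and iness: "\<not> essential_class D C"
  shows "\<exists>a\<in>C. \<exists>b. b \<notin> C \<and> D $ a $ b > 0"
proof (rule ccontr)
  assume no: "\<not> ?thesis"
  from iness obtain i j where i: "i \<in> C" "reaches D i j" "\<not> reaches D j i"
    by (auto simp: essential_class_def essential_def)
  from i(2) have "j \<in> C"
    unfolding reaches_def by (induction rule: rtranclp_induct) (use i(1) no in auto)
  then show False using comm_class_reaches[OF C _ i(1)] i(3) by blast
qed

section \<open>Convergence of the backward accumulations\<close>

theorem theorem2:
  fixes A :: "nat \<Rightarrow> real ^ 'n ^ 'n" and \<tau> :: "nat \<Rightarrow> nat" and \<delta> :: "nat \<Rightarrow> real"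
    and g p :: nat and I :: "nat \<Rightarrow> 'n set" and J :: "'n set"
  assumes "\<And>t. row_stochastic (A t)"
    and "\<And>t. positive_diagonal (A t)"
    and "0 < \<tau> 0" and "strict_mono \<tau>"
    and "\<And>i. same_type (backward_acc A (\<tau> (i + 1)) (\<tau> i)) (backward_acc A (\<tau> 1) (\<tau> 0))"
    and "gantmacher_numbering (backward_acc A (\<tau> 1) (\<tau> 0)) g p I"
    and "\<And>i. diagonal_gantmacher_blocks_positive (backward_acc A (\<tau> (i + 1)) (\<tau> i)) p I"
    and "\<And>i. nondiagonal_gantmacher_blocks_positive_or_zero
               (backward_acc A (\<tau> (i + 1)) (\<tau> i)) g p I"
    and "J = \<Union>{C \<in> comm_classes (backward_acc A (\<tau> 1) (\<tau> 0)).
               \<not> essential_class (backward_acc A (\<tau> 1) (\<tau> 0)) C}"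
    and "\<And>i. pos_min (backward_acc A (\<tau> (i + 1)) (\<tau> i)) \<ge> \<delta> i"
    and "filterlim (\<lambda>N. \<Sum>i=1..N. \<delta> i) at_top sequentially"
  shows "(\<forall>t\<ge>\<tau> 0. backward_acc A t 0 = backward_acc A t (\<tau> 0) ** backward_acc A (\<tau> 0) 0) \<and>
    (\<forall>k\<in>{1..g}. \<exists>K. consensus_block K (I k) \<and>
       block_tendsto (\<lambda>t. backward_acc A t (\<tau> 0)) (I k) (I k) K) \<and>
    (\<forall>k\<in>{1..g}.
       (\<forall>l\<in>{1..g}. l \<noteq> k \<longrightarrow> block_tendsto (\<lambda>t. backward_acc A t (\<tau> 0)) (I k) (I l) 0) \<and>
       block_tendsto (\<lambda>t. backward_acc A t (\<tau> 0)) (I k) J 0) \<and>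
    block_tendsto (\<lambda>t. backward_acc A t (\<tau> 0)) J J 0"
proof -
  define D where "D = backward_acc A (\<tau> 1) (\<tau> 0)"
  interpret same_type_blocks A \<tau> \<delta> D
    using assms(1,2,4,5,10,11) by unfold_locales (simp_all add: D_def)
  note num = assms(6)[folded D_def, unfolded gantmacher_numbering_def]
  have bij: "bij_betw I {1..p} (comm_classes D)" and gp: "g \<le> p"
    using num by blast+
  have cls: "I k \<in> comm_classes D" if "k \<in> {1..p}" for k
    using bij that by (auto simp: bij_betw_def)
  have ess: "essential_class D (I k) \<longleftrightarrow> k \<le> g" if "k \<in> {1..p}" for k
    using num that by blast
  have diag: "D $ a $ b > 0" if "k \<in> {1..p}" "a \<in> I k" "b \<in> I k" for k a b
    using assms(7)[of 0] that
    by (auto simp: D_def diagonal_gantmacher_blocks_positive_def positive_block_def)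
  have reach_edge: "reaches D a b" if "D $ a $ b > 0" for a b
    using that unfolding reaches_def by (rule r_into_rtranclp)
  have class_of: "\<exists>k\<in>{1..p}. b \<in> I k" for b
  proof -
    have "b \<in> \<Union>(comm_classes D)"
      using Union_quotient[OF equiv_communicate[of D]] by (simp add: comm_classes_def)
    then show ?thesis using bij by (auto simp: bij_betw_def)
  qed
  have J_class: "\<exists>k\<in>{g+1..p}. b \<in> I k" if b: "b \<in> J" for b
  proof -
    obtain C where C: "C \<in> comm_classes D" "\<not> essential_class D C" "b \<in> C"
      using b assms(9)[folded D_def] by blast
    then obtain k where k: "k \<in> {1..p}" "C = I k"
      using bij_betw_imp_surj_on[OF bij] by blast
    then show ?thesis using C ess[of k] by (intro bexI[of _ k]) auto
  qed
  have disjoint: "k = l" if "k \<in> {1..p}" "l \<in> {1..p}" "b \<in> I k" "b \<in> I l" for k l b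
  proof -
    have "I k = I l"
      using comm_class_eqI[OF cls cls, OF that] reaches_refl by blast
    then show ?thesis
      using inj_onD[OF bij_betw_imp_inj_on[OF bij]] that by blast
  qed
  have final: "b \<in> I k" if "k \<in> {1..g}" "a \<in> I k" "reaches D a b" for k a b
    using essential_class_closed[OF cls _ that(2,3)] ess[of k] that(1) gp by auto

  have zero: "(\<lambda>t. X t $ a $ b) \<longlonglongrightarrow> 0" if "k \<in> {1..g}" "a \<in> I k" "b \<notin> I k" for k a b
  proof (rule tendsto_eventually)
    have "X t $ a $ b = 0" if "\<tau> 0 \<le> t" for t
    proof (rule ccontr)
      assume "X t $ a $ b \<noteq> 0"
      then have "X t $ a $ b > 0"
        using row_stochastic_nonneg[OF stochastic_acc, of t "\<tau> 0" a b] by simp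
      from final[OF \<open>k \<in> {1..g}\<close> \<open>a \<in> I k\<close> X_pos_imp_reaches[OF that this]] \<open>b \<notin> I k\<close>
      show False by blast
    qed
    then show "\<forall>\<^sub>F t in sequentially. X t $ a $ b = 0"
      unfolding eventually_sequentially by blast
  qed

  have block_k: "\<exists>K. consensus_block K (I k) \<and> block_tendsto X (I k) (I k) K" if k: "k \<in> {1..g}" for k
  proof -
    have k': "k \<in> {1..p}" using k gp by simp
    have ne: "I k \<noteq> {}"
      using cls[OF k'] in_quotient_imp_non_empty[OF equiv_communicate[of D]]
      by (simp add: comm_classes_def)
    have "\<exists>L. \<forall>a\<in>I k. (\<lambda>t. X t $ a $ j) \<longlonglongrightarrow> L" for j
      using column_converges_on_final_class[OF ne] final[OF k] reach_edge diag[OF k'] by blast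
    then obtain L where L: "\<And>j a. a \<in> I k \<Longrightarrow> (\<lambda>t. X t $ a $ j) \<longlonglongrightarrow> L j"
      by metis
    define K :: "real ^ 'n ^ 'n" where "K = (\<chi> a j. L j)"
    have "0 \<le> L j" if "j \<in> I k" for j
      using LIMSEQ_le_const[OF L[OF that]] row_stochastic_nonneg[OF stochastic_acc] by blast
    moreover have "(\<Sum>j\<in>I k. L j) = 1"
    proof -
      obtain a where a: "a \<in> I k" using ne by blast
      have "(\<lambda>t. \<Sum>j\<in>I k. X t $ a $ j) \<longlonglongrightarrow> (\<Sum>j\<in>I k. L j)"
        by (intro tendsto_sum L a)
      moreover have "(\<lambda>t. \<Sum>j\<in>- I k. X t $ a $ j) \<longlonglongrightarrow> (\<Sum>j\<in>- I k. 0)"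
        by (intro tendsto_sum zero[OF k a]) simp
      ultimately have "(\<lambda>t. (\<Sum>j\<in>I k. X t $ a $ j) + (\<Sum>j\<in>- I k. X t $ a $ j)) \<longlonglongrightarrow> (\<Sum>j\<in>I k. L j) + 0"
        by (intro tendsto_add) simp_all
      moreover have "(\<Sum>j\<in>I k. X t $ a $ j) + (\<Sum>j\<in>- I k. X t $ a $ j) = 1" for t
        using row_stochastic_sum[OF stochastic_acc, of t "\<tau> 0" a]
          sum.subset_diff[of "I k" UNIV "\<lambda>j. X t $ a $ j"]
        by (simp add: Compl_eq_Diff_UNIV)
      ultimately show ?thesis by (simp add: LIMSEQ_const_iff)
    qed
    ultimately have "consensus_block K (I k)"
      by (simp add: consensus_block_def K_def)
    moreover have "block_tendsto X (I k) (I k) K"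
      using L by (simp add: block_tendsto_def K_def)
    ultimately show ?thesis by blast
  qed

  (* For a column in J the essential classes are the base of the induction: there it is zero. *)
  have J_vanish: "\<forall>a\<in>I k. (\<lambda>t. X t $ a $ j) \<longlonglongrightarrow> 0" if "j \<in> J" "k \<in> {1..p}" for j k
    using that(2)
  proof (induction k rule: less_induct)
    case (less k)
    show ?case
    proof (cases "k \<le> g")
      case True
      obtain l where l: "l \<in> {g+1..p}" "j \<in> I l" using J_class[OF \<open>j \<in> J\<close>] by blast
      have "j \<notin> I k" using disjoint[OF less.prems _ _ l(2)] l(1) True by auto
      then show ?thesis using zero less.prems True by auto
    next
      case False
      have lower: "\<exists>l\<in>{1..k-1}. b \<in> I l" if "a \<in> I k" "b \<notin> I k" "D $ a $ b > 0" for a b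
      proof -
        obtain l where l: "l \<in> {1..p}" "b \<in> I l" using class_of by blast
        have "class_reaches D (I k) (I l)"
          using that(1) l(2) reach_edge[OF that(3)] by (auto simp: class_reaches_def)
        moreover have "l \<noteq> k" using l(2) that(2) by blast
        ultimately have "l < k" using num l(1) less.prems by blast
        then show ?thesis using l by (intro bexI[of _ l]) auto
      qed
      obtain a0 b0 where ab: "a0 \<in> I k" "b0 \<notin> I k" "D $ a0 $ b0 > 0"
        using inessential_class_has_exit[OF cls[OF less.prems]] ess[OF less.prems] False by blast
      then obtain l where l: "l \<in> {1..k-1}" "b0 \<in> I l" using lower by blast
      (* One edge into the class of b0 makes that whole block positive, so every row has an exit. *)
      have "k \<in> {g+1..p}" using less.prems False by auto
      then have "positive_block D (I k) (I l) \<or> zero_block D (I k) (I l)"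
        using assms(8)[of 0] l(1)
        unfolding nondiagonal_gantmacher_blocks_positive_or_zero_def by (simp add: D_def)
      then have "positive_block D (I k) (I l)"
        using ab l(2) unfolding zero_block_def by force
      then have exit: "\<exists>c. c \<notin> I k \<and> D $ a $ c > 0" if "a \<in> I k" for a
        using that ab(2) l(2) by (auto simp: positive_block_def)
      have out: "(\<lambda>t. X t $ b $ j) \<longlonglongrightarrow> 0" if edge: "a \<in> I k" "b \<notin> I k" "D $ a $ b > 0" for a b
      proof -
        obtain l' where "l' \<in> {1..k-1}" "b \<in> I l'" using lower[OF edge] by blast
        then show ?thesis using less.IH[of l'] less.prems by auto
      qed
      show ?thesis
      proof
        fix a assume "a \<in> I k"
        show "(\<lambda>t. X t $ a $ j) \<longlonglongrightarrow> 0"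
          by (rule column_vanishes_on_transient_class[of "I k"]) (use exit out \<open>a \<in> I k\<close> in blast)+
      qed
    qed
  qed

  show ?thesis
  proof (intro conjI ballI allI impI)
    fix t assume "\<tau> 0 \<le> t"
    then show "backward_acc A t 0 = X t ** backward_acc A (\<tau> 0) 0"
      by (intro backward_acc_compose) auto
  next
    fix k assume "k \<in> {1..g}"
    then show "\<exists>K. consensus_block K (I k) \<and> block_tendsto X (I k) (I k) K" by (rule block_k)
  next
    fix k l assume kl: "k \<in> {1..g}" "l \<in> {1..g}" "l \<noteq> k"
    then have "b \<notin> I k" if "b \<in> I l" for b
      using disjoint[of k l b] that gp by auto
    then show "block_tendsto X (I k) (I l) 0"
      using zero[OF kl(1)] by (auto simp: block_tendsto_def)
  next
    fix k assume k: "k \<in> {1..g}"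
    have "b \<notin> I k" if "b \<in> J" for b
    proof -
      obtain l where "l \<in> {g+1..p}" "b \<in> I l" using J_class[OF \<open>b \<in> J\<close>] by blast
      then show ?thesis using disjoint[of k l b] k gp by auto
    qed
    then show "block_tendsto X (I k) J 0"
      using zero[OF k] by (auto simp: block_tendsto_def)
  next
    show "block_tendsto X J J 0"
      unfolding block_tendsto_def
    proof (intro ballI)
      fix a j assume "a \<in> J" "j \<in> J"
      moreover obtain k where "k \<in> {1..p}" "a \<in> I k" using class_of by blast
      ultimately show "(\<lambda>t. X t $ a $ j) \<longlonglongrightarrow> 0 $ a $ j" using J_vanish by simp
    qed
  qed
qed

end
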